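(* Let $(\Gamma,\Delta,\psi)$ be an abstract zip datum, i.e. $\Gamma$ is a group, $\Delta\subset\Gamma$ a subgroup, and $\psi\colon\Delta\to\Gamma$ a homomorphism. If $\Delta$ is finite, then each equivalence class in $\Gamma$ for the relation $\sim$ has cardinality $\#\Delta$, and the number of equivalence classes is $[\Gamma:\Delta]$.
   Context: For $\gamma\in\Gamma$, write $\mathrm{int}(\gamma)(x)=\gamma x\gamma^{-1}$. $E_\gamma$ denotes the unique largest subgroup $E$ of $\gamma^{-1}\Delta\gamma$ satisfying $\psi(\gamma E\gamma^{-1})=E$ (it is the subgroup generated by all subgroups with this property). For $\gamma,\gamma'\in\Gamma$ write $\gamma'\sim\gamma$ if and only if there exist $\delta\in\Delta$ and $\epsilon\in E_\gamma$ such that $\gamma'=\delta\gamma\epsilon\psi(\delta)^{-1}$. This is an equivalence relation on $\Gamma$. *)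

theory Defs
  imports "HOL-Algebra.Algebra" "HOL-Library.Equipollence"
begin

locale abstract_zip_datum = group \<Gamma> + subgroup \<Delta> \<Gamma>
  for \<Gamma> :: "('a, 'b) monoid_scheme" (structure) and \<Delta> :: "'a set" +
  fixes \<psi> :: "'a \<Rightarrow> 'a"
  assumes psi_hom: "\<psi> \<in> hom (\<Gamma>\<lparr>carrier := \<Delta>\<rparr>) \<Gamma>"

definition int_conj :: "('a, 'b) monoid_scheme \<Rightarrow> 'a \<Rightarrow> 'a \<Rightarrow> 'a" where
  "int_conj \<Gamma> \<gamma> x = \<gamma> \<otimes>\<^bsub>\<Gamma>\<^esub> x \<otimes>\<^bsub>\<Gamma>\<^esub> inv\<^bsub>\<Gamma>\<^esub> \<gamma>"

definition psi_stable_subgroup ::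
  "('a, 'b) monoid_scheme \<Rightarrow> 'a set \<Rightarrow> ('a \<Rightarrow> 'a) \<Rightarrow> 'a \<Rightarrow> 'a set \<Rightarrow> bool" where
  "psi_stable_subgroup \<Gamma> \<Delta> \<psi> \<gamma> E \<longleftrightarrow>
     subgroup E (\<Gamma>\<lparr>carrier := int_conj \<Gamma> (inv\<^bsub>\<Gamma>\<^esub> \<gamma>) ` \<Delta>\<rparr>) \<and>
     \<psi> ` (int_conj \<Gamma> \<gamma> ` E) = E"

text \<open>Largest with respect to inclusion; existence is lemma \<open>zip_E_eq_generate\<close> below.\<close>

definition zip_E ::
  "('a, 'b) monoid_scheme \<Rightarrow> 'a set \<Rightarrow> ('a \<Rightarrow> 'a) \<Rightarrow> 'a \<Rightarrow> 'a set" where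
  "zip_E \<Gamma> \<Delta> \<psi> \<gamma> = (GREATEST E. psi_stable_subgroup \<Gamma> \<Delta> \<psi> \<gamma> E)"

text \<open>A pair \<open>(\<gamma>', \<gamma>)\<close> belongs to the relation iff \<open>\<gamma>' \<sim> \<gamma>\<close>.\<close>

definition zip_rel ::
  "('a, 'b) monoid_scheme \<Rightarrow> 'a set \<Rightarrow> ('a \<Rightarrow> 'a) \<Rightarrow> ('a \<times> 'a) set" where
  "zip_rel \<Gamma> \<Delta> \<psi> = {(\<gamma>', \<gamma>). \<gamma>' \<in> carrier \<Gamma> \<and> \<gamma> \<in> carrier \<Gamma> \<and>
     (\<exists>\<delta>\<in>\<Delta>. \<exists>\<epsilon>\<in>zip_E \<Gamma> \<Delta> \<psi> \<gamma>.
        \<gamma>' = \<delta> \<otimes>\<^bsub>\<Gamma>\<^esub> \<gamma> \<otimes>\<^bsub>\<Gamma>\<^esub> \<epsilon> \<otimes>\<^bsub>\<Gamma>\<^esub> inv\<^bsub>\<Gamma>\<^esub> (\<psi> \<delta>))}"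

context abstract_zip_datum
begin

lemma cancel_left:
  assumes "x \<in> carrier \<Gamma>" "y \<in> carrier \<Gamma>"
  shows "x \<otimes> (inv x \<otimes> y) = y" "inv x \<otimes> (x \<otimes> y) = y"
  using assms by (simp_all flip: m_assoc)

lemma int_conj_hom: "\<gamma> \<in> carrier \<Gamma> \<Longrightarrow> int_conj \<Gamma> \<gamma> \<in> hom \<Gamma> \<Gamma>"
  by (auto simp: hom_def int_conj_def m_assoc cancel_left)

lemma int_conj_inverse:
  assumes "\<gamma> \<in> carrier \<Gamma>" "x \<in> carrier \<Gamma>"
  shows "int_conj \<Gamma> \<gamma> (int_conj \<Gamma> (inv \<gamma>) x) = x"
    and "int_conj \<Gamma> (inv \<gamma>) (int_conj \<Gamma> \<gamma> x) = x"
  using assms by (simp_all add: int_conj_def m_assoc cancel_left)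

lemma subgroup_int_conj:
  assumes "\<gamma> \<in> carrier \<Gamma>" "subgroup H \<Gamma>"
  shows "subgroup (int_conj \<Gamma> \<gamma> ` H) \<Gamma>"
proof -
  interpret h: group_hom \<Gamma> \<Gamma> "int_conj \<Gamma> \<gamma>"
    by unfold_locales (rule int_conj_hom[OF assms(1)])
  show ?thesis using assms(2) by (rule h.subgroup_img_is_subgroup)
qed

lemma psi_stable_subgroup_iff:
  assumes "\<gamma> \<in> carrier \<Gamma>"
  shows "psi_stable_subgroup \<Gamma> \<Delta> \<psi> \<gamma> E \<longleftrightarrow>
    subgroup E \<Gamma> \<and> int_conj \<Gamma> \<gamma> ` E \<subseteq> \<Delta> \<and> \<psi> ` (int_conj \<Gamma> \<gamma> ` E) = E"
proof -
  let ?K = "int_conj \<Gamma> (inv \<gamma>) ` \<Delta>"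
  have K: "subgroup ?K \<Gamma>"
    using assms by (intro subgroup_int_conj) (auto intro: subgroup_axioms)
  have "subgroup E (\<Gamma>\<lparr>carrier := ?K\<rparr>) \<longleftrightarrow> subgroup E \<Gamma> \<and> E \<subseteq> ?K"
    using incl_subgroup[OF K, of E] subgroup_incl[of E, OF _ K]
      subgroup.subset[of E "\<Gamma>\<lparr>carrier := ?K\<rparr>"] by auto
  moreover have "E \<subseteq> ?K \<longleftrightarrow> int_conj \<Gamma> \<gamma> ` E \<subseteq> \<Delta>" if "subgroup E \<Gamma>"
  proof
    assume *: "E \<subseteq> ?K"
    show "int_conj \<Gamma> \<gamma> ` E \<subseteq> \<Delta>"
    proof
      fix y assume "y \<in> int_conj \<Gamma> \<gamma> ` E"
      then obtain d where "d \<in> \<Delta>" "y = int_conj \<Gamma> \<gamma> (int_conj \<Gamma> (inv \<gamma>) d)"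
        using * by blast
      then show "y \<in> \<Delta>" using int_conj_inverse(1)[OF assms, of d] by auto
    qed
  next
    assume *: "int_conj \<Gamma> \<gamma> ` E \<subseteq> \<Delta>"
    show "E \<subseteq> ?K"
    proof
      fix x assume x: "x \<in> E"
      then have "x \<in> carrier \<Gamma>" using that subgroup.subset by blast
      then have "x = int_conj \<Gamma> (inv \<gamma>) (int_conj \<Gamma> \<gamma> x)"
        using int_conj_inverse(2)[OF assms] by simp
      then show "x \<in> ?K" using * x by blast
    qed
  qed
  ultimately show ?thesis unfolding psi_stable_subgroup_def by blast
qed

lemma psi_stable_subgroup_generate:
  assumes g: "\<gamma> \<in> carrier \<Gamma>"
  defines "U \<equiv> \<Union>{E. psi_stable_subgroup \<Gamma> \<Delta> \<psi> \<gamma> E}"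
  shows "psi_stable_subgroup \<Gamma> \<Delta> \<psi> \<gamma> (generate \<Gamma> U)"
proof -
  let ?K = "int_conj \<Gamma> (inv \<gamma>) ` \<Delta>" and ?f = "\<psi> \<circ> int_conj \<Gamma> \<gamma>"
  have K: "subgroup ?K \<Gamma>"
    using g by (intro subgroup_int_conj) (auto intro: subgroup_axioms)
  have mem: "int_conj \<Gamma> \<gamma> x \<in> \<Delta>" if "x \<in> ?K" for x
    using that g by (auto simp: int_conj_inverse)
  have Kc: "?K \<subseteq> carrier \<Gamma>" using K subgroup.subset by blast
  have "?f \<in> hom (\<Gamma>\<lparr>carrier := ?K\<rparr>) \<Gamma>"
  proof (rule homI)
    fix x assume "x \<in> carrier (\<Gamma>\<lparr>carrier := ?K\<rparr>)"
    then show "?f x \<in> carrier \<Gamma>" using mem psi_hom by (auto simp: hom_def)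
  next
    fix x y assume "x \<in> carrier (\<Gamma>\<lparr>carrier := ?K\<rparr>)" "y \<in> carrier (\<Gamma>\<lparr>carrier := ?K\<rparr>)"
    then have xy: "x \<in> ?K" "y \<in> ?K" by simp_all
    have "int_conj \<Gamma> \<gamma> (x \<otimes> y) = int_conj \<Gamma> \<gamma> x \<otimes> int_conj \<Gamma> \<gamma> y"
      using hom_mult[OF int_conj_hom[OF g]] xy Kc by blast
    moreover have "\<psi> (int_conj \<Gamma> \<gamma> x \<otimes> int_conj \<Gamma> \<gamma> y) =
        \<psi> (int_conj \<Gamma> \<gamma> x) \<otimes> \<psi> (int_conj \<Gamma> \<gamma> y)"
      using hom_mult[OF psi_hom] mem xy by simp
    ultimately show "?f (x \<otimes>\<^bsub>\<Gamma>\<lparr>carrier := ?K\<rparr>\<^esub> y) = ?f x \<otimes> ?f y" by simp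
  qed
  then interpret f: group_hom "\<Gamma>\<lparr>carrier := ?K\<rparr>" \<Gamma> ?f
    using subgroup_imp_group[OF K] is_group by (simp add: group_hom_def group_hom_axioms_def)
  have UK: "U \<subseteq> ?K"
    unfolding U_def psi_stable_subgroup_def using subgroup.subset by fastforce
  have fU: "?f ` U = U"
  proof -
    have "?f ` E = E" if "psi_stable_subgroup \<Gamma> \<Delta> \<psi> \<gamma> E" for E
      using that unfolding psi_stable_subgroup_def by (simp add: image_comp)
    then show ?thesis unfolding U_def image_Union by (intro arg_cong[of _ _ Union]) (auto simp: image_iff)
  qed
  have cons: "generate (\<Gamma>\<lparr>carrier := ?K\<rparr>) U = generate \<Gamma> U"
    using generate_consistent[OF UK K] by simp
  have "subgroup (generate \<Gamma> U) (\<Gamma>\<lparr>carrier := ?K\<rparr>)"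
    using f.G.generate_is_subgroup[of U] UK cons by simp
  moreover have "?f ` generate \<Gamma> U = generate \<Gamma> U"
    using f.generate_img[of U] UK cons fU by simp
  ultimately show ?thesis
    unfolding psi_stable_subgroup_def by (simp add: image_comp)
qed

lemma zip_E_eq_generate:
  assumes g: "\<gamma> \<in> carrier \<Gamma>"
  shows "zip_E \<Gamma> \<Delta> \<psi> \<gamma> = generate \<Gamma> (\<Union>{E. psi_stable_subgroup \<Gamma> \<Delta> \<psi> \<gamma> E})"
  unfolding zip_E_def
  using psi_stable_subgroup_generate[OF g] by (rule Greatest_equality) (auto intro: generate.incl)

lemma zip_E_stable: "\<gamma> \<in> carrier \<Gamma> \<Longrightarrow> psi_stable_subgroup \<Gamma> \<Delta> \<psi> \<gamma> (zip_E \<Gamma> \<Delta> \<psi> \<gamma>)"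
  by (simp add: zip_E_eq_generate psi_stable_subgroup_generate)

lemma zip_E_greatest:
  "\<gamma> \<in> carrier \<Gamma> \<Longrightarrow> psi_stable_subgroup \<Gamma> \<Delta> \<psi> \<gamma> E \<Longrightarrow> E \<subseteq> zip_E \<Gamma> \<Delta> \<psi> \<gamma>"
  by (auto simp: zip_E_eq_generate intro: generate.incl)

lemma psi_closed [simp]: "\<delta> \<in> \<Delta> \<Longrightarrow> \<psi> \<delta> \<in> carrier \<Gamma>"
  using psi_hom by (auto simp: hom_def)

lemma psi_mult: "\<delta> \<in> \<Delta> \<Longrightarrow> \<delta>' \<in> \<Delta> \<Longrightarrow> \<psi> (\<delta> \<otimes> \<delta>') = \<psi> \<delta> \<otimes> \<psi> \<delta>'"
  using psi_hom by (auto simp: hom_def)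

lemma psi_one: "\<psi> \<one> = \<one>"
proof -
  have "\<psi> \<one> \<otimes> \<psi> \<one> = \<psi> \<one>" using psi_mult[of \<one> \<one>] by simp
  then show ?thesis using l_cancel_one[of "\<psi> \<one>" "\<psi> \<one>"] by simp
qed

lemma psi_inv: "\<delta> \<in> \<Delta> \<Longrightarrow> \<psi> (inv \<delta>) = inv (\<psi> \<delta>)"
  using psi_mult[of "inv \<delta>" \<delta>] by (simp add: inv_equality psi_one)

lemma zip_E_subgroup: "\<gamma> \<in> carrier \<Gamma> \<Longrightarrow> subgroup (zip_E \<Gamma> \<Delta> \<psi> \<gamma>) \<Gamma>"
  using zip_E_stable psi_stable_subgroup_iff by blast

lemma zip_E_conj_subset:
  assumes g: "\<gamma> \<in> carrier \<Gamma>" and d: "\<delta> \<in> \<Delta>" and e: "\<epsilon> \<in> zip_E \<Gamma> \<Delta> \<psi> \<gamma>"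
    and g': "\<gamma>' = \<delta> \<otimes> \<gamma> \<otimes> \<epsilon> \<otimes> inv (\<psi> \<delta>)"
  shows "int_conj \<Gamma> (\<psi> \<delta>) ` zip_E \<Gamma> \<Delta> \<psi> \<gamma> \<subseteq> zip_E \<Gamma> \<Delta> \<psi> \<gamma>'"
proof -
  let ?E = "zip_E \<Gamma> \<Delta> \<psi> \<gamma>" and ?E' = "int_conj \<Gamma> (\<psi> \<delta>) ` zip_E \<Gamma> \<Delta> \<psi> \<gamma>"
  have sub: "subgroup ?E \<Gamma>" using g by (rule zip_E_subgroup)
  interpret E: subgroup ?E \<Gamma> by (rule sub)
  have st: "int_conj \<Gamma> \<gamma> ` ?E \<subseteq> \<Delta>" "\<psi> ` (int_conj \<Gamma> \<gamma> ` ?E) = ?E"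
    using zip_E_stable[OF g] psi_stable_subgroup_iff[OF g] by blast+
  have c: "\<delta> \<in> carrier \<Gamma>" "\<epsilon> \<in> carrier \<Gamma>" "\<psi> \<delta> \<in> carrier \<Gamma>" using d e by auto
  have g'c: "\<gamma>' \<in> carrier \<Gamma>" using g c g' by simp
  have step: "int_conj \<Gamma> \<gamma>' (int_conj \<Gamma> (\<psi> \<delta>) x) = int_conj \<Gamma> \<delta> (int_conj \<Gamma> \<gamma> (int_conj \<Gamma> \<epsilon> x))"
    if "x \<in> ?E" for x
    using that g c by (simp add: g' int_conj_def m_assoc cancel_left inv_mult_group)
  have "int_conj \<Gamma> \<epsilon> ` ?E = ?E"
  proof
    show "int_conj \<Gamma> \<epsilon> ` ?E \<subseteq> ?E" using e by (auto simp: int_conj_def)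
    show "?E \<subseteq> int_conj \<Gamma> \<epsilon> ` ?E"
    proof
      fix x assume x: "x \<in> ?E"
      then have "int_conj \<Gamma> (inv \<epsilon>) x \<in> ?E" using e by (simp add: int_conj_def)
      moreover have "x = int_conj \<Gamma> \<epsilon> (int_conj \<Gamma> (inv \<epsilon>) x)"
        using x c by (simp add: int_conj_inverse)
      ultimately show "x \<in> int_conj \<Gamma> \<epsilon> ` ?E" by blast
    qed
  qed
  then have img: "int_conj \<Gamma> \<gamma>' ` ?E' = int_conj \<Gamma> \<delta> ` int_conj \<Gamma> \<gamma> ` ?E"
  proof -
    have "int_conj \<Gamma> \<gamma>' ` ?E' = int_conj \<Gamma> \<delta> ` int_conj \<Gamma> \<gamma> ` int_conj \<Gamma> \<epsilon> ` ?E"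
      unfolding image_image by (rule image_cong[OF refl step])
    then show ?thesis using \<open>int_conj \<Gamma> \<epsilon> ` ?E = ?E\<close> by simp
  qed
  have sD: "int_conj \<Gamma> \<delta> y \<in> \<Delta>" if "y \<in> \<Delta>" for y
    using that d by (simp add: int_conj_def)
  have psiD: "\<psi> (int_conj \<Gamma> \<delta> y) = int_conj \<Gamma> (\<psi> \<delta>) (\<psi> y)" if "y \<in> \<Delta>" for y
    using that d by (simp add: int_conj_def psi_mult psi_inv)
  have "\<psi> ` (int_conj \<Gamma> \<delta> ` int_conj \<Gamma> \<gamma> ` ?E) = int_conj \<Gamma> (\<psi> \<delta>) ` \<psi> ` (int_conj \<Gamma> \<gamma> ` ?E)"
    unfolding image_image using st(1) by (intro image_cong refl psiD) auto
  then have "\<psi> ` (int_conj \<Gamma> \<gamma>' ` ?E') = ?E'" using img st(2) by simp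
  moreover have "int_conj \<Gamma> \<gamma>' ` ?E' \<subseteq> \<Delta>" unfolding img using st(1) sD by blast
  moreover have "subgroup ?E' \<Gamma>" by (rule subgroup_int_conj[OF c(3) sub])
  ultimately have "psi_stable_subgroup \<Gamma> \<Delta> \<psi> \<gamma>' ?E'"
    using psi_stable_subgroup_iff[OF g'c] by blast
  then show ?thesis by (rule zip_E_greatest[OF g'c])
qed

lemma zip_rel_inverse:
  assumes g: "\<gamma> \<in> carrier \<Gamma>" and d: "\<delta> \<in> \<Delta>" and e: "\<epsilon> \<in> zip_E \<Gamma> \<Delta> \<psi> \<gamma>"
    and g': "\<gamma>' = \<delta> \<otimes> \<gamma> \<otimes> \<epsilon> \<otimes> inv (\<psi> \<delta>)"
  shows "int_conj \<Gamma> (\<psi> \<delta>) (inv \<epsilon>) \<in> zip_E \<Gamma> \<Delta> \<psi> \<gamma>'"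
    and "\<gamma> = inv \<delta> \<otimes> \<gamma>' \<otimes> int_conj \<Gamma> (\<psi> \<delta>) (inv \<epsilon>) \<otimes> inv (\<psi> (inv \<delta>))"
proof -
  interpret E: subgroup "zip_E \<Gamma> \<Delta> \<psi> \<gamma>" \<Gamma> using g by (rule zip_E_subgroup)
  show "int_conj \<Gamma> (\<psi> \<delta>) (inv \<epsilon>) \<in> zip_E \<Gamma> \<Delta> \<psi> \<gamma>'"
    using zip_E_conj_subset[OF assms] e by blast
  have "\<delta> \<in> carrier \<Gamma>" "\<epsilon> \<in> carrier \<Gamma>" "\<psi> \<delta> \<in> carrier \<Gamma>" using d e by auto
  then show "\<gamma> = inv \<delta> \<otimes> \<gamma>' \<otimes> int_conj \<Gamma> (\<psi> \<delta>) (inv \<epsilon>) \<otimes> inv (\<psi> (inv \<delta>))"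
    using g d by (simp add: g' int_conj_def psi_inv m_assoc cancel_left inv_mult_group)
qed

lemma equiv_zip_rel: "equiv (carrier \<Gamma>) (zip_rel \<Gamma> \<Delta> \<psi>)"
proof (rule equivI)
  show "zip_rel \<Gamma> \<Delta> \<psi> \<subseteq> carrier \<Gamma> \<times> carrier \<Gamma>" by (auto simp: zip_rel_def)
  show "refl_on (carrier \<Gamma>) (zip_rel \<Gamma> \<Delta> \<psi>)"
  proof (rule refl_onI)
    fix x assume x: "x \<in> carrier \<Gamma>"
    then have "\<one> \<in> zip_E \<Gamma> \<Delta> \<psi> x" using zip_E_subgroup subgroup.one_closed by blast
    moreover have "x = \<one> \<otimes> x \<otimes> \<one> \<otimes> inv (\<psi> \<one>)" using x by (simp add: psi_one)
    moreover have "\<one> \<in> \<Delta>" by (rule subgroup.one_closed[OF subgroup_axioms])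
    ultimately show "(x, x) \<in> zip_rel \<Gamma> \<Delta> \<psi>" using x unfolding zip_rel_def by blast
  qed
  show "sym (zip_rel \<Gamma> \<Delta> \<psi>)"
  proof (rule symI)
    fix x y assume "(x, y) \<in> zip_rel \<Gamma> \<Delta> \<psi>"
    then obtain d e where *: "x \<in> carrier \<Gamma>" "y \<in> carrier \<Gamma>" "d \<in> \<Delta>" "e \<in> zip_E \<Gamma> \<Delta> \<psi> y"
      "x = d \<otimes> y \<otimes> e \<otimes> inv (\<psi> d)" by (auto simp: zip_rel_def)
    from zip_rel_inverse[OF *(2-5)] *(1-3) subgroup.m_inv_closed[OF subgroup_axioms *(3)]
    show "(y, x) \<in> zip_rel \<Gamma> \<Delta> \<psi>"
      unfolding zip_rel_def by blast
  qed
  show "trans (zip_rel \<Gamma> \<Delta> \<psi>)"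
  proof (rule transI)
    fix x y z assume "(x, y) \<in> zip_rel \<Gamma> \<Delta> \<psi>" "(y, z) \<in> zip_rel \<Gamma> \<Delta> \<psi>"
    then obtain d e d' e' where *: "x \<in> carrier \<Gamma>" "y \<in> carrier \<Gamma>" "z \<in> carrier \<Gamma>"
      "d \<in> \<Delta>" "e \<in> zip_E \<Gamma> \<Delta> \<psi> z" "y = d \<otimes> z \<otimes> e \<otimes> inv (\<psi> d)"
      "d' \<in> \<Delta>" "e' \<in> zip_E \<Gamma> \<Delta> \<psi> y" "x = d' \<otimes> y \<otimes> e' \<otimes> inv (\<psi> d')"
      by (auto simp: zip_rel_def)
    interpret Ez: subgroup "zip_E \<Gamma> \<Delta> \<psi> z" \<Gamma> using *(3) by (rule zip_E_subgroup)
    interpret Ey: subgroup "zip_E \<Gamma> \<Delta> \<psi> y" \<Gamma> using *(2) by (rule zip_E_subgroup)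
    let ?e = "int_conj \<Gamma> (\<psi> (inv d)) e'"
    have "?e \<in> zip_E \<Gamma> \<Delta> \<psi> z"
      using zip_E_conj_subset[OF *(2) _ zip_rel_inverse[OF *(3-6)]] *(4,8) by blast
    then have m: "e \<otimes> ?e \<in> zip_E \<Gamma> \<Delta> \<psi> z" using *(5) by simp
    have "d \<in> carrier \<Gamma>" "d' \<in> carrier \<Gamma>" "e \<in> carrier \<Gamma>" "e' \<in> carrier \<Gamma>" using * by auto
    then have "x = (d' \<otimes> d) \<otimes> z \<otimes> (e \<otimes> ?e) \<otimes> inv (\<psi> (d' \<otimes> d))"
      using *(3,4,7) by (subst *(9), subst *(6))
        (simp add: int_conj_def psi_inv psi_mult m_assoc cancel_left inv_mult_group)
    then show "(x, z) \<in> zip_rel \<Gamma> \<Delta> \<psi>"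
      using m *(1,3) subgroup.m_closed[OF subgroup_axioms *(7,4)] unfolding zip_rel_def by blast
  qed
qed

end

end

theory Submission
  imports Defs
begin

text \<open>The class of \<open>\<gamma>\<close> is the image of \<open>\<Delta> \<times> E\<^sub>\<gamma>\<close> under
  \<open>(\<delta>, \<epsilon>) \<mapsto> \<delta>\<gamma>\<epsilon>\<psi>(\<delta>)\<^sup>-\<^sup>1\<close>. If two pairs have the same image, then
  \<open>e = \<gamma>\<^sup>-\<^sup>1\<delta>\<^sub>2\<^sup>-\<^sup>1\<delta>\<^sub>1\<gamma>\<close> satisfies \<open>\<psi>(\<gamma>e\<gamma>\<^sup>-\<^sup>1) \<in> E\<^sub>\<gamma> e E\<^sub>\<gamma>\<close>,
  so the subgroup generated by \<open>E\<^sub>\<gamma>\<close> and \<open>e\<close> is \<open>\<psi>\<close>-stable and hence \<open>e \<in> E\<^sub>\<gamma>\<close> by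
  maximality. Therefore all fibres have \<open>#E\<^sub>\<gamma>\<close> elements, and the class has \<open>#\<Delta>\<close> elements.
  As the classes and the right cosets of \<open>\<Delta>\<close> both partition \<open>\<Gamma>\<close> into blocks of the same
  finite nonzero size, there are equally many of them.\<close>

text \<open>\<Gamma> may be infinite, so the two numbers of blocks are compared by equipollence. For
  infinite \<open>A\<close> and \<open>B\<close> the finite nonempty factor \<open>D\<close> is
  absorbed; for finite ones the cardinality of \<open>D\<close> is divided out.\<close>

lemma eqpoll_times_finite_cancel:
  assumes eq: "A \<times> D \<approx> B \<times> D" and D: "finite D" "D \<noteq> {}"
  shows "A \<approx> B"
proof -
  have inf: "C \<times> D \<approx> C" if "infinite C" for C
    unfolding eqpoll_iff_card_of_ordIso
    using that D by (intro card_of_Times_infinite[THEN conjunct1]) (auto intro: ordLess_imp_ordLeq)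
  have fin: "finite A \<longleftrightarrow> finite B"
    using eqpoll_finite_iff[OF eq] D by (auto simp: finite_cartesian_product_iff)
  show ?thesis
  proof (cases "finite A")
    case True
    then have "card A * card D = card B * card D"
      using eqpoll_iff_card[of "A \<times> D" "B \<times> D"] eq fin D by (simp add: card_cartesian_product)
    then show ?thesis
      using True fin D eqpoll_iff_card[of A B] by simp
  next
    case False
    then show ?thesis
      using inf[of A] inf[of B] fin eq by (meson eqpoll_sym eqpoll_trans)
  qed
qed

lemma card_eq_constant_fibres:
  assumes "finite A" and "\<And>y. y \<in> f ` A \<Longrightarrow> card {x \<in> A. f x = y} = k"
  shows "card A = card (f ` A) * k"
proof -
  have "card A = (\<Sum>y\<in>f ` A. card {x \<in> A. f x = y})"
    using sum.image_gen[OF assms(1), of "\<lambda>_. 1::nat" f] by (simp only: card_eq_sum)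
  also have "\<dots> = (\<Sum>y\<in>f ` A. k)"
    using assms(2) by (rule sum.cong[OF refl])
  finally show ?thesis by simp
qed

context abstract_zip_datum
begin

text \<open>\<psi>-stability of E says that this map sends E onto itself. Being a homomorphism, it
  carries a generated subgroup to the subgroup generated by the images.\<close>

lemma psi_int_conj_group_hom:
  assumes g: "\<gamma> \<in> carrier \<Gamma>"
  shows "group_hom (\<Gamma>\<lparr>carrier := int_conj \<Gamma> (inv \<gamma>) ` \<Delta>\<rparr>) \<Gamma> (\<psi> \<circ> int_conj \<Gamma> \<gamma>)"
proof -
  let ?K = "int_conj \<Gamma> (inv \<gamma>) ` \<Delta>"
  have K: "subgroup ?K \<Gamma>"
    using g by (intro subgroup_int_conj) (auto intro: subgroup_axioms)
  have Kc: "?K \<subseteq> carrier \<Gamma>" using K subgroup.subset by blast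
  have mem: "int_conj \<Gamma> \<gamma> x \<in> \<Delta>" if "x \<in> ?K" for x
    using that g by (auto simp: int_conj_inverse)
  have "\<psi> \<circ> int_conj \<Gamma> \<gamma> \<in> hom (\<Gamma>\<lparr>carrier := ?K\<rparr>) \<Gamma>"
  proof (rule homI)
    fix x y assume "x \<in> carrier (\<Gamma>\<lparr>carrier := ?K\<rparr>)" "y \<in> carrier (\<Gamma>\<lparr>carrier := ?K\<rparr>)"
    then have xy: "x \<in> ?K" "y \<in> ?K" by simp_all
    then have "int_conj \<Gamma> \<gamma> (x \<otimes> y) = int_conj \<Gamma> \<gamma> x \<otimes> int_conj \<Gamma> \<gamma> y"
      using hom_mult[OF int_conj_hom[OF g]] Kc by blast
    then show "(\<psi> \<circ> int_conj \<Gamma> \<gamma>) (x \<otimes>\<^bsub>\<Gamma>\<lparr>carrier := ?K\<rparr>\<^esub> y) =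
        (\<psi> \<circ> int_conj \<Gamma> \<gamma>) x \<otimes> (\<psi> \<circ> int_conj \<Gamma> \<gamma>) y"
      using mem xy by (simp add: psi_mult)
  qed (use mem in auto)
  then show ?thesis
    using subgroup_imp_group[OF K] is_group by (simp add: group_hom_def group_hom_axioms_def)
qed

text \<open>Adjoining \<open>x\<close> to E_\<gamma> gives another stable subgroup, so maximality
  forces \<open>x\<close> to lie in E_\<gamma> already. This bounds the fibres from above.\<close>

lemma mem_zip_E_of_double_coset:
  assumes g: "\<gamma> \<in> carrier \<Gamma>" and x: "x \<in> carrier \<Gamma>" "int_conj \<Gamma> \<gamma> x \<in> \<Delta>"
    and e: "\<epsilon> \<in> zip_E \<Gamma> \<Delta> \<psi> \<gamma>" "\<epsilon>' \<in> zip_E \<Gamma> \<Delta> \<psi> \<gamma>"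
    and psi: "\<psi> (int_conj \<Gamma> \<gamma> x) = \<epsilon> \<otimes> x \<otimes> \<epsilon>'"
  shows "x \<in> zip_E \<Gamma> \<Delta> \<psi> \<gamma>"
proof -
  let ?K = "int_conj \<Gamma> (inv \<gamma>) ` \<Delta>" and ?f = "\<psi> \<circ> int_conj \<Gamma> \<gamma>"
  let ?E = "zip_E \<Gamma> \<Delta> \<psi> \<gamma>"
  interpret f: group_hom "\<Gamma>\<lparr>carrier := ?K\<rparr>" \<Gamma> ?f by (rule psi_int_conj_group_hom[OF g])
  interpret E: subgroup ?E \<Gamma> by (rule zip_E_subgroup[OF g])
  have K: "subgroup ?K \<Gamma>"
    using g by (intro subgroup_int_conj) (auto intro: subgroup_axioms)
  have "?E \<subseteq> ?K"
    using zip_E_stable[OF g] subgroup.subset unfolding psi_stable_subgroup_def by fastforce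
  moreover have "x \<in> ?K"
    using int_conj_inverse(2)[OF g x(1)] x(2) by (metis image_eqI)
  ultimately have UK: "insert x ?E \<subseteq> ?K" by simp
  have fU: "?f ` insert x ?E = insert (\<epsilon> \<otimes> x \<otimes> \<epsilon>') ?E"
    using zip_E_stable[OF g] psi by (simp add: psi_stable_subgroup_def image_comp)
  \<comment> \<open>The new generator differs from \<open>x\<close> only by factors in
    \<open>?E\<close>, which can be multiplied in or cancelled.\<close>
  have gen: "generate \<Gamma> (insert (\<epsilon> \<otimes> x \<otimes> \<epsilon>') ?E) = generate \<Gamma> (insert x ?E)"
  proof (rule antisym; rule generate_subgroup_incl)
    have "\<epsilon> \<otimes> x \<otimes> \<epsilon>' \<in> generate \<Gamma> (insert x ?E)"
      using e by (intro generate.eng generate.incl) auto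
    then show "insert (\<epsilon> \<otimes> x \<otimes> \<epsilon>') ?E \<subseteq> generate \<Gamma> (insert x ?E)"
      by (auto intro: generate.incl)
    have "inv \<epsilon> \<otimes> (\<epsilon> \<otimes> x \<otimes> \<epsilon>') \<otimes> inv \<epsilon>' \<in> generate \<Gamma> (insert (\<epsilon> \<otimes> x \<otimes> \<epsilon>') ?E)"
      using e by (intro generate.eng generate.incl) auto
    moreover have "inv \<epsilon> \<otimes> (\<epsilon> \<otimes> x \<otimes> \<epsilon>') \<otimes> inv \<epsilon>' = x"
      using e x(1) E.subset by (simp add: m_assoc cancel_left subset_iff)
    ultimately show "insert x ?E \<subseteq> generate \<Gamma> (insert (\<epsilon> \<otimes> x \<otimes> \<epsilon>') ?E)"
      by (auto intro: generate.incl)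
  qed (use e x(1) E.subset in \<open>auto intro!: generate_is_subgroup\<close>)
  \<comment> \<open>The homomorphism is only available on \<open>?K\<close>, so generation is moved
    there.\<close>
  have cons: "generate (\<Gamma>\<lparr>carrier := ?K\<rparr>) (insert x ?E) = generate \<Gamma> (insert x ?E)"
    using generate_consistent[OF UK K] by simp
  have "subgroup (generate \<Gamma> (insert x ?E)) (\<Gamma>\<lparr>carrier := ?K\<rparr>)"
    using f.G.generate_is_subgroup[of "insert x ?E"] UK cons by simp
  moreover have "?f ` generate \<Gamma> (insert x ?E) = generate \<Gamma> (insert x ?E)"
    using f.generate_img[of "insert x ?E"] UK cons fU gen by simp
  ultimately have "psi_stable_subgroup \<Gamma> \<Delta> \<psi> \<gamma> (generate \<Gamma> (insert x ?E))"
    unfolding psi_stable_subgroup_def by (simp add: image_comp)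
  from zip_E_greatest[OF g this] show ?thesis
    by (auto intro: generate.incl)
qed

text \<open>Replacing \<delta> by \<delta>\<gamma>x\<gamma>^-1 without changing the value of
  \<open>F\<close> forces the second component given here. Stability keeps both components in range
  for x in E_\<gamma>; surjectivity is the part that needs maximality.\<close>

lemma zip_fibre_bij:
  assumes g: "\<gamma> \<in> carrier \<Gamma>" and d: "\<delta> \<in> \<Delta>" and e: "\<epsilon> \<in> zip_E \<Gamma> \<Delta> \<psi> \<gamma>"
  defines "F \<equiv> (\<lambda>(\<delta>, \<epsilon>). \<delta> \<otimes> \<gamma> \<otimes> \<epsilon> \<otimes> inv (\<psi> \<delta>))"
  shows "bij_betw (\<lambda>x. (\<delta> \<otimes> int_conj \<Gamma> \<gamma> x, inv x \<otimes> \<epsilon> \<otimes> \<psi> (int_conj \<Gamma> \<gamma> x)))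
    (zip_E \<Gamma> \<Delta> \<psi> \<gamma>) {p \<in> \<Delta> \<times> zip_E \<Gamma> \<Delta> \<psi> \<gamma>. F p = F (\<delta>, \<epsilon>)}"
    (is "bij_betw ?h ?E ?P")
proof -
  interpret E: subgroup ?E \<Gamma> by (rule zip_E_subgroup[OF g])
  have st: "int_conj \<Gamma> \<gamma> x \<in> \<Delta>" "\<psi> (int_conj \<Gamma> \<gamma> x) \<in> ?E" if "x \<in> ?E" for x
    using zip_E_stable[OF g] that psi_stable_subgroup_iff[OF g] by blast+
  have c: "\<delta> \<in> carrier \<Gamma>" "\<epsilon> \<in> carrier \<Gamma>" "\<psi> \<delta> \<in> carrier \<Gamma>" using d e by auto
  have "?h x \<in> ?P" if x: "x \<in> ?E" for x
  proof -
    have "\<delta> \<otimes> int_conj \<Gamma> \<gamma> x \<in> \<Delta>" "inv x \<otimes> \<epsilon> \<otimes> \<psi> (int_conj \<Gamma> \<gamma> x) \<in> ?E"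
      using d st[OF x] e x by (auto intro: subgroup.m_closed[OF subgroup_axioms])
    moreover have "F (?h x) = F (\<delta>, \<epsilon>)"
    proof -
      define a where "a = \<psi> (int_conj \<Gamma> \<gamma> x)"
      have a: "a \<in> carrier \<Gamma>" using st(2)[OF x] by (simp add: a_def)
      have "\<psi> (\<delta> \<otimes> int_conj \<Gamma> \<gamma> x) = \<psi> \<delta> \<otimes> a"
        using d st(1)[OF x] by (simp add: psi_mult a_def)
      moreover have "\<delta> \<otimes> int_conj \<Gamma> \<gamma> x \<otimes> \<gamma> \<otimes> (inv x \<otimes> \<epsilon> \<otimes> a) \<otimes> inv (\<psi> \<delta> \<otimes> a) =
          \<delta> \<otimes> \<gamma> \<otimes> \<epsilon> \<otimes> inv (\<psi> \<delta>)"
        using c g x a by (simp add: int_conj_def inv_mult_group m_assoc cancel_left)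
      ultimately show ?thesis by (simp add: F_def flip: a_def)
    qed
    ultimately show ?thesis by simp
  qed
  moreover have "inj_on ?h ?E"
  proof (rule inj_onI)
    fix x y assume xy: "x \<in> ?E" "y \<in> ?E" "?h x = ?h y"
    then have "\<delta> \<otimes> int_conj \<Gamma> \<gamma> x = \<delta> \<otimes> int_conj \<Gamma> \<gamma> y" by simp
    then have "int_conj \<Gamma> \<gamma> x = int_conj \<Gamma> \<gamma> y" using c st(1)[OF xy(1)] st(1)[OF xy(2)] by simp
    then show "x = y" using int_conj_inverse(2)[OF g] xy(1,2) E.mem_carrier by metis
  qed
  moreover have "p \<in> ?h ` ?E" if p: "p \<in> ?P" for p
  proof -
    obtain d' e' where de: "p = (d', e')" "d' \<in> \<Delta>" "e' \<in> ?E"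
      and eq: "d' \<otimes> \<gamma> \<otimes> e' \<otimes> inv (\<psi> d') = \<delta> \<otimes> \<gamma> \<otimes> \<epsilon> \<otimes> inv (\<psi> \<delta>)"
      using p by (auto simp: F_def)
    have c': "d' \<in> carrier \<Gamma>" "e' \<in> carrier \<Gamma>" "\<psi> d' \<in> carrier \<Gamma>" using de by auto
    \<comment> \<open>The only candidate for a preimage: it solves d' =
      \<delta>\<gamma>x\<gamma>^-1. At first it is only known to lie in
      \<gamma>^-1\<Delta>\<gamma>.\<close>
    define x where "x = int_conj \<Gamma> (inv \<gamma>) (inv \<delta> \<otimes> d')"
    have xc: "x \<in> carrier \<Gamma>" using g c c' by (simp add: x_def int_conj_def)
    have gx: "int_conj \<Gamma> \<gamma> x = inv \<delta> \<otimes> d'"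
      unfolding x_def using g c c' by (simp add: int_conj_inverse)
    have mem: "inv \<delta> \<otimes> d' \<in> \<Delta>"
      using d de by (auto intro: subgroup.m_closed[OF subgroup_axioms]
          subgroup.m_inv_closed[OF subgroup_axioms])
    have psix: "\<psi> (int_conj \<Gamma> \<gamma> x) = inv (\<psi> \<delta>) \<otimes> \<psi> d'"
      unfolding gx using d de by (simp add: psi_mult psi_inv subgroup.m_inv_closed[OF subgroup_axioms])
    \<comment> \<open>Multiplying \<open>eq\<close> by (\<delta>\<gamma>\<epsilon>)^-1 on the left
      and by \<psi>(d') on the right exhibits \<psi>(\<gamma>x\<gamma>^-1) in the double coset
      E_\<gamma> x E_\<gamma>.\<close>
    have "inv \<epsilon> \<otimes> x \<otimes> e' =
        inv \<epsilon> \<otimes> inv \<gamma> \<otimes> inv \<delta> \<otimes> (d' \<otimes> \<gamma> \<otimes> e' \<otimes> inv (\<psi> d')) \<otimes> \<psi> d'"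
      using g c c' by (simp add: x_def int_conj_def m_assoc cancel_left)
    also have "\<dots> = \<psi> (int_conj \<Gamma> \<gamma> x)"
      unfolding eq psix using g c c' by (simp add: m_assoc cancel_left)
    finally have psix': "\<psi> (int_conj \<Gamma> \<gamma> x) = inv \<epsilon> \<otimes> x \<otimes> e'" ..
    have "x \<in> ?E"
      using mem_zip_E_of_double_coset[OF g xc _ _ de(3) psix'] mem gx e by simp
    moreover have "?h x = p"
      unfolding psix' unfolding gx de(1) using xc c c' by (simp add: m_assoc cancel_left)
    ultimately show ?thesis by blast
  qed
  ultimately show ?thesis unfolding bij_betw_def by blast
qed

lemma zip_class_eq_image:
  assumes g: "\<gamma> \<in> carrier \<Gamma>"
  shows "zip_rel \<Gamma> \<Delta> \<psi> `` {\<gamma>} =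
    (\<lambda>(\<delta>, \<epsilon>). \<delta> \<otimes> \<gamma> \<otimes> \<epsilon> \<otimes> inv (\<psi> \<delta>)) ` (\<Delta> \<times> zip_E \<Gamma> \<Delta> \<psi> \<gamma>)"
    (is "_ = ?R")
proof -
  \<comment> \<open>The relational image collects the \<gamma>' with \<gamma> ~ \<gamma>', where
    \<epsilon> ranges over the varying E_\<gamma>'. Symmetry exchanges this for the fixed group
    E_\<gamma>.\<close>
  have "sym (zip_rel \<Gamma> \<Delta> \<psi>)" using equiv_zip_rel by (simp add: equiv_def)
  then have "zip_rel \<Gamma> \<Delta> \<psi> `` {\<gamma>} = {\<gamma>'. (\<gamma>', \<gamma>) \<in> zip_rel \<Gamma> \<Delta> \<psi>}" by (auto dest: symD)
  also have "\<dots> = ?R \<inter> carrier \<Gamma>" using g by (auto simp: zip_rel_def)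
  also have "\<dots> = ?R" using g subgroup.mem_carrier[OF zip_E_subgroup[OF g]] by auto
  finally show ?thesis .
qed

lemma zip_class_finite_card:
  assumes fin: "finite \<Delta>" and g: "\<gamma> \<in> carrier \<Gamma>"
  shows "finite (zip_rel \<Gamma> \<Delta> \<psi> `` {\<gamma>})" and "card (zip_rel \<Gamma> \<Delta> \<psi> `` {\<gamma>}) = card \<Delta>"
proof -
  let ?E = "zip_E \<Gamma> \<Delta> \<psi> \<gamma>" and ?F = "\<lambda>(\<delta>, \<epsilon>). \<delta> \<otimes> \<gamma> \<otimes> \<epsilon> \<otimes> inv (\<psi> \<delta>)"
  have "\<psi> ` (int_conj \<Gamma> \<gamma> ` ?E) = ?E" "int_conj \<Gamma> \<gamma> ` ?E \<subseteq> \<Delta>"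
    using zip_E_stable[OF g] psi_stable_subgroup_iff[OF g] by blast+
  \<comment> \<open>Stability presents E_\<gamma> as the image under \<psi> of a subset of
    \<Delta>.\<close>
  then have finE: "finite ?E" using fin by (metis finite_imageI finite_subset)
  have "?E \<noteq> {}" using subgroup.one_closed[OF zip_E_subgroup[OF g]] by blast
  then have pos: "card ?E > 0" using finE by (simp add: card_gt_0_iff)
  show "finite (zip_rel \<Gamma> \<Delta> \<psi> `` {\<gamma>})"
    using fin finE by (simp add: zip_class_eq_image[OF g])
  have "card (\<Delta> \<times> ?E) = card (?F ` (\<Delta> \<times> ?E)) * card ?E"
  proof (rule card_eq_constant_fibres)
    fix y assume "y \<in> ?F ` (\<Delta> \<times> ?E)"
    then obtain d e where "d \<in> \<Delta>" "e \<in> ?E" "y = ?F (d, e)" by blast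
    then show "card {p \<in> \<Delta> \<times> ?E. ?F p = y} = card ?E"
      using bij_betw_same_card[OF zip_fibre_bij[OF g, of d e]] by simp
  qed (use fin finE in simp)
  then show "card (zip_rel \<Gamma> \<Delta> \<psi> `` {\<gamma>}) = card \<Delta>"
    using pos by (simp add: card_cartesian_product zip_class_eq_image[OF g])
qed

end

theorem theorem9p6:
  fixes \<Gamma> :: "('a, 'b) monoid_scheme" and \<Delta> :: "'a set" and \<psi> :: "'a \<Rightarrow> 'a"
  assumes "abstract_zip_datum \<Gamma> \<Delta> \<psi>"
    and "finite \<Delta>"
  shows "(\<forall>C \<in> carrier \<Gamma> // zip_rel \<Gamma> \<Delta> \<psi>. finite C \<and> card C = card \<Delta>) \<and>
         carrier \<Gamma> // zip_rel \<Gamma> \<Delta> \<psi> \<approx> rcosets\<^bsub>\<Gamma>\<^esub> \<Delta>"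
proof -
  interpret abstract_zip_datum \<Gamma> \<Delta> \<psi> by fact
  let ?Q = "carrier \<Gamma> // zip_rel \<Gamma> \<Delta> \<psi>"
  have cls: "\<forall>C \<in> ?Q. finite C \<and> card C = card \<Delta>"
    using zip_class_finite_card[OF assms(2)] by (auto elim!: quotientE)
  have "(\<Union>C\<in>?Q. C) \<approx> ?Q \<times> \<Delta>"
  proof (rule Union_eqpoll_Times)
    show "pairwise disjnt ?Q"
      using quotient_disj[OF equiv_zip_rel] by (auto simp: pairwise_def disjnt_def)
  qed (use cls assms(2) in \<open>simp add: eqpoll_iff_card\<close>)
  moreover have "(\<Union>C\<in>rcosets\<^bsub>\<Gamma>\<^esub> \<Delta>. C) \<approx> (rcosets\<^bsub>\<Gamma>\<^esub> \<Delta>) \<times> \<Delta>"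
  proof (rule Union_eqpoll_Times)
    show "C \<approx> \<Delta>" if "C \<in> rcosets\<^bsub>\<Gamma>\<^esub> \<Delta>" for C
      using card_cosets_equal[OF that subset] unfolding eqpoll_def by (meson bij_betw_inv)
  qed (rule rcos_disjoint[OF subgroup_axioms])
  \<comment> \<open>Both unions are the whole of \<Gamma>, cut into disjoint blocks equipollent to
    \<Delta>.\<close>
  ultimately have prod: "?Q \<times> \<Delta> \<approx> (rcosets\<^bsub>\<Gamma>\<^esub> \<Delta>) \<times> \<Delta>"
    unfolding image_ident Union_quotient[OF equiv_zip_rel] rcosets_part_G[OF subgroup_axioms]
    by (meson eqpoll_sym eqpoll_trans)
  have "\<Delta> \<noteq> {}" using subgroup.one_closed[OF subgroup_axioms] by blast
  with prod assms(2) have "?Q \<approx> rcosets\<^bsub>\<Gamma>\<^esub> \<Delta>"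
    by (rule eqpoll_times_finite_cancel)
  with cls show ?thesis by blast
qed

end
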